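(* (Design Composition Theorem I) Let $D=\{m\}_n$ be a finite design ($n\ge0$, $0\le m\le 2^n-1$) and let $D'$ be an arbitrary design (finite, infinite, or terminal). Then \[ \mathcal{A}(\theta_{DD'})=U(D)\,\mathcal{A}(\theta_{D'}). \]
   Context: Stern's diatomic integers: for integers $n\ge0$, $0\le m\le 2^n$, define $[2^0:0]=0$, $[2^0:1]=1$, $[2^{n+1}:2m]=[2^n:m]$, $[2^{n+1}:2m+1]=[2^n:m]+[2^n:m+1]$. Assembly function: the map $m/2^n\mapsto [2^n:m]/[2^n:2^n-m]$ ($0\le m\le 2^n-1$) on dyadic rationals in $[0,1)$ extends uniquely to a continuous strictly increasing bijection $\mathcal{A}:[0,1)\to[0,\infty)$; one sets $\mathcal{A}(1)=\infty$. Designs: a finite design $\{m\}_n$ ($0\le m\le2^n-1$) is the binary word $d_1\cdots d_n$ of length $n$ (leading zeros allowed, empty if $n=0$) with $\sum 2^{n-i}d_i=m$; its design decimal is $\theta=\sum_{i}d_i2^{-i}=m/2^n$. An infinite design is an infinite binary sequence $d_1d_2\cdots$ that is not eventually constant; its design decimal is $\theta=\sum_{i\ge1}d_i2^{-i}$. The terminal design $\{2^{n'}\}_{n'}$ ($n'\ge0$) is a formal symbol with design decimal $1$. Composition: for finite $D=\{m\}_n$ and finite or infinite $D'$, $DD'$ is the concatenation of words, so $\theta_{DD'}=\theta_D+2^{-n}\theta_{D'}$ (for finite $D'=\{m'\}_{n'}$, $DD'=\{2^{n'}m+m'\}_{n+n'}$); for $D'$ terminal of length $n'$, $DD'=\{2^{n'}(m+1)\}_{n+n'}$,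 which is a finite design when $m\ne 2^n-1$ and the terminal design of length $n+n'$ when $m=2^n-1$; in all cases $\theta_{DD'}=(m+\theta_{D'})/2^n$. Matrix action: for $D=\{m\}_n$, $U(D)=\begin{pmatrix}a&b\\c&d\end{pmatrix}=\begin{pmatrix}[2^n:m+1]&[2^n:m]\\ [2^n:2^n-(m+1)]&[2^n:2^n-m]\end{pmatrix}$, and $U(D)x=(ax+b)/(cx+d)$ for real $x\ge0$, $U(D)\infty=a/c$ (interpreted as $\infty$ if $c=0$). *)

theory Defs
  imports "HOL-Analysis.Analysis"
begin

section \<open>Stern's diatomic integers\<close>

(* stern n m is [2^n : m]; only the arguments m \<le> 2^n are meaningful. *)
fun stern :: "nat \<Rightarrow> nat \<Rightarrow> nat" where
  "stern 0 m = (if m = 0 then 0 else 1)"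
| "stern (Suc n) m =
    (if even m then stern n (m div 2) else stern n (m div 2) + stern n (m div 2 + 1))"

lemma stern_even: "stern (Suc n) (2 * m) = stern n m"
  by simp

lemma stern_odd: "stern (Suc n) (2 * m + 1) = stern n m + stern n (m + 1)"
  by simp

declare stern.simps(2) [simp del]

section \<open>The assembly function\<close>

definition extends_dyadic_quotients :: "(real \<Rightarrow> real) \<Rightarrow> bool" where
  "extends_dyadic_quotients f \<longleftrightarrow>
    (\<forall>n m. m < 2 ^ n \<longrightarrow> f (real m / 2 ^ n) = real (stern n m) / real (stern n (2 ^ n - m)))"

definition is_assembly :: "(real \<Rightarrow> real) \<Rightarrow> bool" where
  "is_assembly f \<longleftrightarrow> extends_dyadic_quotients f \<and> continuous_on {0..<1} f \<and>
    strict_mono_on {0..<1} f \<and> bij_betw f {0..<1} {0..}"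

(* Existence and uniqueness are lemma ex1_is_assembly below; extensionality only fixes the
   irrelevant values outside [0,1). *)
definition assembly_fun :: "real \<Rightarrow> real" where
  "assembly_fun = (THE f. f \<in> extensional {0..<1} \<and> is_assembly f)"

definition assembly :: "real \<Rightarrow> ereal" where
  "assembly \<theta> = (if \<theta> = 1 then \<infinity> else ereal (assembly_fun \<theta>))"

subsection \<open>Existence and uniqueness\<close>

lemma stern_0 [simp]: "stern n 0 = 0"
  by (induction n) (simp_all add: stern.simps(2))

lemma stern_pos: "0 < m \<Longrightarrow> m \<le> 2 ^ n \<Longrightarrow> 0 < stern n m"
proof (induction n arbitrary: m)
  case (Suc n)
  show ?case
  proof (cases "even m")
    case True
    then obtain k where "m = 2 * k" by auto
    then show ?thesis using Suc by (simp add: stern_even)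
  next
    case False
    then obtain k where "m = 2 * k + 1" by (auto elim: oddE)
    then show ?thesis using Suc.IH[of "k + 1"] Suc.prems stern_odd[of n k] by simp
  qed
qed simp

lemma stern_top_low: "m \<le> 2 ^ n \<Longrightarrow> stern (Suc n) m = stern n m"
proof (induction n arbitrary: m)
  case 0
  then have "m = 0 \<or> m = 1" by auto
  then show ?case by (auto simp: stern.simps(2))
next
  case (Suc n)
  show ?case
  proof (cases "even m")
    case True
    then obtain k where "m = 2 * k" by auto
    then show ?thesis using Suc by (simp add: stern_even)
  next
    case False
    then obtain k where "m = 2 * k + 1" by (auto elim: oddE)
    moreover from this have "k + 1 \<le> 2 ^ n" using Suc.prems by simp
    ultimately show ?thesis using Suc.IH[of k] Suc.IH[of "k + 1"]
      stern_odd[of n k] stern_odd[of "Suc n" k] by simp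
  qed
qed

lemma stern_top_high:
  "m \<le> 2 ^ n \<Longrightarrow> stern (Suc n) (2 ^ n + m) = stern n m + stern n (2 ^ n - m)"
proof (induction n arbitrary: m)
  case 0
  then have "m = 0 \<or> m = 1" by auto
  then show ?case by (auto simp: stern.simps)
next
  case (Suc n)
  show ?case
  proof (cases "even m")
    case True
    then obtain k where k: "m = 2 * k" by auto
    have eqs: "2 ^ Suc n + m = 2 * (2 ^ n + k)" "2 ^ Suc n - m = 2 * (2 ^ n - k)"
      using k by auto
    show ?thesis unfolding eqs unfolding k stern_even
      by (rule Suc.IH) (use k Suc.prems in simp)
  next
    case False
    then obtain k where k: "m = 2 * k + 1" by (auto elim: oddE)
    have le: "k + 1 \<le> 2 ^ n" using k Suc.prems by simp
    have eqs: "2 ^ Suc n + m = 2 * (2 ^ n + k) + 1"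
      "2 ^ Suc n - m = 2 * (2 ^ n - (k + 1)) + 1" "2 ^ n - (k + 1) + 1 = 2 ^ n - k"
      using k le by auto
    show ?thesis unfolding eqs unfolding k stern_odd eqs
      using Suc.IH[of k] Suc.IH[of "k + 1"] le by (simp add: algebra_simps)
  qed
qed

lemma stern_shift: "stern (n + k) (2 ^ k * m) = stern n m"
proof (induction k)
  case (Suc k)
  then show ?case using stern_even[of "n + k" "2 ^ k * m"] by (simp add: mult.assoc)
qed simp

lemma stern_unimodular:
  "m < 2 ^ n \<Longrightarrow> stern n (m + 1) * stern n (2 ^ n - m) =
     stern n m * stern n (2 ^ n - (m + 1)) + 1"
proof (induction n arbitrary: m)
  case (Suc n)
  show ?case
  proof (cases "even m")
    case True
    then obtain k where k: "m = 2 * k" by auto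
    have lt: "k < 2 ^ n" using k Suc.prems by simp
    have eqs: "2 ^ Suc n - m = 2 * (2 ^ n - k)"
      "2 ^ Suc n - (m + 1) = 2 * (2 ^ n - (k + 1)) + 1" "2 ^ n - (k + 1) + 1 = 2 ^ n - k"
      using k lt by auto
    show ?thesis unfolding eqs unfolding k stern_odd stern_even eqs
      using Suc.IH[OF lt] by (simp add: algebra_simps)
  next
    case False
    then obtain k where k: "m = 2 * k + 1" by (auto elim: oddE)
    have lt: "k < 2 ^ n" using k Suc.prems by simp
    have eqs: "2 ^ Suc n - m = 2 * (2 ^ n - (k + 1)) + 1"
      "2 ^ Suc n - (m + 1) = 2 * (2 ^ n - (k + 1))" "2 ^ n - (k + 1) + 1 = 2 ^ n - k"
      using k lt by auto
    have eq: "m + 1 = 2 * (k + 1)" using k by simp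
    show ?thesis unfolding eqs unfolding eq unfolding k stern_odd stern_even eqs
      using Suc.IH[OF lt] by (simp add: algebra_simps)
  qed
qed simp

definition dyadic_quotient :: "nat \<Rightarrow> nat \<Rightarrow> real" where
  "dyadic_quotient n m = real (stern n m) / real (stern n (2 ^ n - m))"

lemma dyadic_quotient_shift: "dyadic_quotient (n + k) (2 ^ k * m) = dyadic_quotient n m"
proof -
  have "2 ^ (n + k) - 2 ^ k * m = 2 ^ k * (2 ^ n - m)"
    by (simp add: power_add algebra_simps)
  then show ?thesis by (simp add: dyadic_quotient_def stern_shift)
qed

lemma dyadic_quotient_Suc:
  assumes "m + 1 < 2 ^ n" shows "dyadic_quotient n m < dyadic_quotient n (m + 1)"
proof -
  have pos: "0 < stern n (2 ^ n - m)" "0 < stern n (2 ^ n - (m + 1))"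
    using assms by (auto intro!: stern_pos)
  have "stern n m * stern n (2 ^ n - (m + 1)) < stern n (m + 1) * stern n (2 ^ n - m)"
    using stern_unimodular[of m n] assms by simp
  then have "real (stern n m) * real (stern n (2 ^ n - (m + 1)))
      < real (stern n (m + 1)) * real (stern n (2 ^ n - m))"
    by (metis of_nat_less_iff of_nat_mult)
  then show ?thesis using pos by (simp add: dyadic_quotient_def divide_simps del: of_nat_mult)
qed

lemma dyadic_quotient_less:
  assumes "m < m'" "m' < 2 ^ n" shows "dyadic_quotient n m < dyadic_quotient n m'"
  using assms
proof (induction m' rule: less_induct)
  case (less k)
  then obtain j where j: "k = j + 1" by (cases k) auto
  have "dyadic_quotient n j < dyadic_quotient n k"
    using dyadic_quotient_Suc less.prems j by simp
  then show ?case using less.IH[of j] less.prems j by (cases "m = j") auto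
qed

definition dyadic_graph :: "(real \<times> real) set" where
  "dyadic_graph = {(real m / 2 ^ n, dyadic_quotient n m) | n m. m < 2 ^ n}"

lemma dyadic_graph_less:
  assumes "(d, r) \<in> dyadic_graph" "(e, s) \<in> dyadic_graph" "d < e" shows "r < s"
proof -
  obtain n m k j where
    1: "m < 2 ^ n" "d = real m / 2 ^ n" "r = dyadic_quotient n m" and
    2: "j < 2 ^ k" "e = real j / 2 ^ k" "s = dyadic_quotient k j"
    using assms unfolding dyadic_graph_def by auto
  have "real (2 ^ k * m) < real (2 ^ n * j)"
    using assms(3) 1 2 by (simp add: field_simps)
  then have "2 ^ k * m < 2 ^ n * j" by (simp only: of_nat_less_iff)
  moreover have "2 ^ n * j < 2 ^ (n + k)" using 2(1) by (simp add: power_add)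
  ultimately have "dyadic_quotient (n + k) (2 ^ k * m) < dyadic_quotient (n + k) (2 ^ n * j)"
    by (rule dyadic_quotient_less)
  then show ?thesis
    using dyadic_quotient_shift[of n k m] dyadic_quotient_shift[of k n j] 1 2
    by (simp add: add.commute)
qed

lemma dyadic_graph_eq:
  assumes "(d, r) \<in> dyadic_graph" "(d, s) \<in> dyadic_graph" shows "r = s"
proof -
  obtain n m k j where
    1: "m < 2 ^ n" "d = real m / 2 ^ n" "r = dyadic_quotient n m" and
    2: "j < 2 ^ k" "d = real j / 2 ^ k" "s = dyadic_quotient k j"
    using assms unfolding dyadic_graph_def by auto
  have "real (2 ^ k * m) = real (2 ^ n * j)"
    using 1 2 by (simp add: field_simps)
  then have "2 ^ k * m = 2 ^ n * j" by (simp only: of_nat_eq_iff)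
  then show ?thesis
    using dyadic_quotient_shift[of n k m] dyadic_quotient_shift[of k n j] 1 2
    by (simp add: add.commute)
qed

lemma dyadic_graph_range:
  assumes "(d, r) \<in> dyadic_graph" shows "0 \<le> d" "d < 1" "0 \<le> r"
proof -
  obtain n m where 1: "m < 2 ^ n" "d = real m / 2 ^ n" "r = dyadic_quotient n m"
    using assms unfolding dyadic_graph_def by auto
  have "real m < 2 ^ n" using 1(1) by (metis of_nat_less_numeral_power_cancel_iff)
  then show "0 \<le> d" "d < 1" "0 \<le> r" using 1 by (simp_all add: dyadic_quotient_def)
qed

lemma dyadic_graph_dense_dom:
  assumes "0 \<le> x" "x < y" "y \<le> 1" shows "\<exists>d r. (d, r) \<in> dyadic_graph \<and> x < d \<and> d < y"
proof -
  obtain n where "(1/2::real) ^ n < y - x"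
    using assms real_arch_pow_inv[of "y - x" "1/2"] by auto
  then have n: "1 < (y - x) * 2 ^ n" by (simp add: field_simps)
  define m where "m = nat \<lfloor>x * 2 ^ n\<rfloor> + 1"
  have m: "x * 2 ^ n < real m" "real m \<le> x * 2 ^ n + 1"
    using assms(1) floor_correct[of "x * 2 ^ n"] by (simp_all add: m_def add.commute)
  have my: "real m < y * 2 ^ n" using m n by (simp add: algebra_simps)
  also have "\<dots> \<le> 1 * 2 ^ n" using assms by (intro mult_right_mono) auto
  finally have "m < 2 ^ n" by simp
  then have "(real m / 2 ^ n, dyadic_quotient n m) \<in> dyadic_graph"
    unfolding dyadic_graph_def by auto
  moreover have "x < real m / 2 ^ n" "real m / 2 ^ n < y"
    using m my by (simp_all add: field_simps)
  ultimately show ?thesis by blast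
qed

lemma dyadic_quotient_onto:
  "0 < b \<Longrightarrow> \<exists>n m. m < 2 ^ n \<and> dyadic_quotient n m = real a / real b"
proof (induction "a + b" arbitrary: a b rule: less_induct)
  case less
  consider "a = 0" | "0 < a" "a < b" | "b \<le> a" by linarith
  then show ?case
  proof cases
    case 1
    then show ?thesis by (intro exI[of _ 0]) (simp add: dyadic_quotient_def)
  next
    case 2
    then obtain n m where nm: "m < 2 ^ n" "dyadic_quotient n m = real a / real (b - a)"
      using less.hyps[of a "b - a"] by auto
    have q: "0 < stern n (2 ^ n - m)" using nm(1) by (auto intro: stern_pos)
    have "2 ^ Suc n - m = 2 ^ n + (2 ^ n - m)" using nm(1) by simp
    then have "stern (Suc n) (2 ^ Suc n - m) = stern n (2 ^ n - m) + stern n m"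
      using stern_top_high[of "2 ^ n - m" n] nm(1) by simp
    moreover have "stern (Suc n) m = stern n m" using nm(1) by (simp add: stern_top_low)
    moreover have "real (stern n m) * (real b - real a) = real a * real (stern n (2 ^ n - m))"
      using nm(2) q 2 by (simp add: dyadic_quotient_def field_simps of_nat_diff)
    ultimately have "dyadic_quotient (Suc n) m = real a / real b"
      using q 2 by (simp add: dyadic_quotient_def field_simps add_pos_nonneg)
    moreover have "m < 2 ^ Suc n" using nm(1) by simp
    ultimately show ?thesis by blast
  next
    case 3
    then obtain n m where nm: "m < 2 ^ n" "dyadic_quotient n m = real (a - b) / real b"
      using less.hyps[of "a - b" b] less.prems by auto
    have q: "0 < stern n (2 ^ n - m)" using nm(1) by (auto intro: stern_pos)
    have "2 ^ Suc n - (2 ^ n + m) = 2 ^ n - m" by simp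
    then have "stern (Suc n) (2 ^ Suc n - (2 ^ n + m)) = stern n (2 ^ n - m)"
      by (simp only:) (simp add: stern_top_low)
    moreover have "stern (Suc n) (2 ^ n + m) = stern n m + stern n (2 ^ n - m)"
      using nm(1) by (simp add: stern_top_high)
    ultimately have "dyadic_quotient (Suc n) (2 ^ n + m) = dyadic_quotient n m + 1"
      using q unfolding dyadic_quotient_def by (simp add: field_simps)
    also have "\<dots> = real a / real b"
      using nm(2) 3 less.prems by (simp add: of_nat_diff field_simps)
    finally have "dyadic_quotient (Suc n) (2 ^ n + m) = real a / real b" .
    moreover have "2 ^ n + m < 2 ^ Suc n" using nm(1) by simp
    ultimately show ?thesis by blast
  qed
qed

lemma dyadic_graph_dense_ran:
  assumes "0 \<le> x" "x < y" shows "\<exists>d r. (d, r) \<in> dyadic_graph \<and> x < r \<and> r < y"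
proof -
  obtain r where r: "r \<in> \<rat>" "x < r" "r < y" using Rats_dense_in_real assms by blast
  then have "0 \<le> r" using assms by simp
  then obtain a b :: nat where ab: "b \<noteq> 0" "r = real a / real b"
    using Rats_abs_nat_div_natE[OF r(1)] by (metis abs_of_nonneg)
  then obtain n m where "m < 2 ^ n" "dyadic_quotient n m = r"
    using dyadic_quotient_onto[of b a] by auto
  then show ?thesis using r unfolding dyadic_graph_def by auto
qed

lemma ex_is_assembly: "\<exists>f. is_assembly f"
proof -
  let ?R = dyadic_graph
  define S where "S x = {r. \<exists>d. (d, r) \<in> ?R \<and> d \<le> x}" for x
  define f where "f x = Sup (S x)" for x
  have zero: "(0, 0) \<in> ?R"
    unfolding dyadic_graph_def by (auto intro!: exI[of _ 0] simp: dyadic_quotient_def)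
  have ne: "S x \<noteq> {}" if "0 \<le> x" for x using zero that unfolding S_def by auto
  have le: "f x \<le> r" if "(d, r) \<in> ?R" "x \<le> d" "0 \<le> x" for x d r
    unfolding f_def
  proof (rule cSup_least[OF ne[OF that(3)]])
    fix s assume "s \<in> S x"
    then obtain e where e: "(e, s) \<in> ?R" "e \<le> x" unfolding S_def by auto
    show "s \<le> r"
      using dyadic_graph_less[OF e(1) that(1)] dyadic_graph_eq[OF e(1)] that e(2)
      by (cases "e = d") force+
  qed
  have bdd: "bdd_above (S x)" if x: "0 \<le> x" "x < 1" for x
  proof -
    obtain d r where d: "(d, r) \<in> ?R" "x < d" using dyadic_graph_dense_dom[of x 1] x by auto
    show ?thesis
      using dyadic_graph_less[OF _ d(1)] d(2) unfolding S_def
      by (intro bdd_aboveI[of _ r]) force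
  qed
  have ge: "r \<le> f x" if "(d, r) \<in> ?R" "d \<le> x" "x < 1" for x d r
    unfolding f_def
    by (rule cSup_upper) (use that bdd dyadic_graph_range[OF that(1)] in \<open>auto simp: S_def\<close>)
  have eq: "f d = r" if "(d, r) \<in> ?R" for d r
    using le[OF that, of d] ge[OF that, of d] dyadic_graph_range[OF that] by linarith
  have mono: "f x < f y" if xy: "0 \<le> x" "x < y" "y < 1" for x y
  proof -
    obtain d r where d: "(d, r) \<in> ?R" "x < d" "d < y"
      using dyadic_graph_dense_dom[of x y] xy by auto
    obtain e s where e: "(e, s) \<in> ?R" "d < e" "e < y"
      using dyadic_graph_dense_dom[of d y] xy d by auto
    show ?thesis
      using le[OF d(1), of x] ge[OF e(1), of y] dyadic_graph_less[OF d(1) e(1)] d e xy by linarith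
  qed
  have nonneg: "0 \<le> f x" if "0 \<le> x" "x < 1" for x using ge[OF zero] that by simp
  have onto: "\<exists>x. 0 \<le> x \<and> x < 1 \<and> f x = y" if y: "0 \<le> y" for y
  proof -
    define T where "T = {d. \<exists>r. (d, r) \<in> ?R \<and> r \<le> y}"
    define x where "x = Sup T"
    have T0: "0 \<in> T" using zero y unfolding T_def by auto
    have ub: "e \<le> d" if "(d, r) \<in> ?R" "y < r" "e \<in> T" for d r e
      using that dyadic_graph_less[OF that(1)] unfolding T_def by force
    obtain d1 r1 where d1: "(d1, r1) \<in> ?R" "y < r1"
      using dyadic_graph_dense_ran[of y "y + 1"] y by auto
    have bT: "bdd_above T" using ub[OF d1] by (intro bdd_aboveI)
    have xle: "x \<le> d" if "(d, r) \<in> ?R" "y < r" for d r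
      unfolding x_def by (rule cSup_least) (use T0 ub[OF that] in auto)
    have x: "0 \<le> x" "x < 1"
      using cSup_upper[OF T0 bT] xle[OF d1] dyadic_graph_range[OF d1(1)] unfolding x_def by auto
    have "\<not> f x < y"
    proof
      assume "f x < y"
      then obtain d r where d: "(d, r) \<in> ?R" "f x < r" "r < y"
        using dyadic_graph_dense_ran[of "f x" y] nonneg x by auto
      then have "d \<in> T" unfolding T_def by auto
      then have "d \<le> x" unfolding x_def by (rule cSup_upper[OF _ bT])
      then show False using ge[OF d(1), of x] x d by linarith
    qed
    moreover have "\<not> y < f x"
    proof
      assume "y < f x"
      then obtain d r where d: "(d, r) \<in> ?R" "y < r" "r < f x"
        using dyadic_graph_dense_ran[of y "f x"] y by auto
      then show False using le[OF d(1) xle[OF d(1,2)]] x by auto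
    qed
    ultimately show ?thesis using x by (intro exI[of _ x]) auto
  qed
  have sm: "strict_mono_on {0..<1} f" by (rule strict_mono_onI) (use mono in auto)
  have im: "f ` {0..<1} = {0..}"
    using nonneg onto by (fastforce simp: image_iff)
  define g where "g x = (if x < 0 then x else f x)" for x
  have "g ` {..<1} = UNIV"
  proof (intro set_eqI iffI UNIV_I)
    fix y :: real
    show "y \<in> g ` {..<1}"
    proof (cases "y < 0")
      case True
      then show ?thesis by (intro image_eqI[of _ _ y]) (auto simp: g_def)
    next
      case False
      then obtain x where "0 \<le> x" "x < 1" "f x = y" using onto[of y] by auto
      then show ?thesis by (intro image_eqI[of _ _ x]) (auto simp: g_def)
    qed
  qed
  then have "continuous_on {..<1} g"
  proof (intro continuous_onI_mono)
    fix x y :: real assume "x \<in> {..<1}" "y \<in> {..<1}" "x \<le> y"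
    then show "g x \<le> g y"
      using mono[of x y] nonneg[of y] by (cases "x = y") (auto simp: g_def)
  qed simp
  then have "continuous_on {0..<1} g" by (rule continuous_on_subset) auto
  then have "continuous_on {0..<1} f"
    by (rule continuous_on_eq) (auto simp: g_def)
  moreover have "extends_dyadic_quotients f"
    unfolding extends_dyadic_quotients_def
    using eq by (auto simp: dyadic_graph_def dyadic_quotient_def)
  ultimately have "is_assembly f"
    using sm im strict_mono_on_imp_inj_on[OF sm] by (auto simp: is_assembly_def bij_betw_def)
  then show ?thesis by blast
qed

lemma is_assembly_unique:
  assumes f: "is_assembly f" and g: "is_assembly g" and x: "x \<in> {0..<1}"
  shows "f x = g x"
proof (rule ccontr)
  have less: False
    if h: "is_assembly h" "is_assembly k" and hk: "h x < k x" for h k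
  proof -
    have hx: "0 \<le> h x" using h(1) x unfolding is_assembly_def bij_betw_def by auto
    obtain d r where d: "(d, r) \<in> dyadic_graph" "h x < r" "r < k x"
      using dyadic_graph_dense_ran[OF hx hk] by auto
    then have "h d = r" "k d = r" "d \<in> {0..<1}"
      using h dyadic_graph_range[OF d(1)]
      unfolding is_assembly_def extends_dyadic_quotients_def dyadic_graph_def dyadic_quotient_def
      by auto
    moreover have "strict_mono_on {0..<1} h" "strict_mono_on {0..<1} k"
      using h unfolding is_assembly_def by auto
    ultimately have "x < d" "d < x"
      using d(2,3) x strict_mono_on_less[of "{0..<1}" h x d] strict_mono_on_less[of "{0..<1}" k d x]
      by auto
    then show False by simp
  qed
  assume "f x \<noteq> g x"
  then show False using less[OF f g] less[OF g f] by linarith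
qed

lemma ex1_is_assembly: "\<exists>!f. f \<in> extensional {0..<1} \<and> is_assembly f"
proof -
  obtain f where f: "is_assembly f" using ex_is_assembly by blast
  let ?g = "restrict f {0..<1}"
  have dy: "real m / 2 ^ n \<in> {0..<1}" if "m < 2 ^ n" for m n :: nat
    using that by (simp add: divide_simps)
  have "continuous_on {0..<1} ?g = continuous_on {0..<1} f"
    by (rule continuous_on_cong) auto
  moreover have "bij_betw ?g {0..<1} {0..} = bij_betw f {0..<1} {0..}"
    by (rule bij_betw_cong) auto
  ultimately have "is_assembly ?g"
    using f dy unfolding is_assembly_def extends_dyadic_quotients_def
    by (auto simp: strict_mono_on_def)
  moreover have "h = k"
    if "h \<in> extensional {0..<1}" "is_assembly h" "k \<in> extensional {0..<1}" "is_assembly k"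
    for h k
    using that is_assembly_unique by (intro extensionalityI) auto
  ultimately show ?thesis by blast
qed

lemma is_assembly_assembly_fun: "is_assembly assembly_fun"
  using theI'[OF ex1_is_assembly] unfolding assembly_fun_def by blast

section \<open>Designs\<close>

(* A word d_1 ... d_n is a list of bits with d_(i+1) stored at position i; likewise for
   sequences. *)
definition word_value :: "bool list \<Rightarrow> nat" where
  "word_value w = (\<Sum>i<length w. 2 ^ (length w - (i + 1)) * of_bool (w ! i))"

definition finite_design :: "nat \<Rightarrow> nat \<Rightarrow> bool list" where
  "finite_design m n = (THE w. length w = n \<and> word_value w = m)"

lemma word_value_snoc: "word_value (w @ [b]) = 2 * word_value w + of_bool b"
proof -
  have "(\<Sum>i<length w. 2 ^ (length w - i) * of_bool ((w @ [b]) ! i) :: nat)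
      = (\<Sum>i<length w. 2 * (2 ^ (length w - (i + 1)) * of_bool (w ! i)))"
    by (intro sum.cong refl) (auto simp: nth_append simp flip: power_Suc Suc_diff_Suc)
  then show ?thesis
    unfolding word_value_def sum_distrib_left by (simp del: sum_mult_of_bool_eq sum_of_bool_mult_eq)
qed

lemma ex1_word: "m < 2 ^ n \<Longrightarrow> \<exists>!w. length w = n \<and> word_value w = m"
proof (induction n arbitrary: m)
  case 0
  then show ?case by (auto simp: word_value_def)
next
  case (Suc n)
  then obtain v where v: "length v = n" "word_value v = m div 2"
    and uniq: "\<And>u. length u = n \<Longrightarrow> word_value u = m div 2 \<Longrightarrow> u = v"
    by (metis less_mult_imp_div_less power_Suc2)
  show ?case
  proof (rule ex1I[of _ "v @ [odd m]"])
    show "length (v @ [odd m]) = Suc n \<and> word_value (v @ [odd m]) = m"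
      using v by (auto simp: word_value_snoc)
  next
    fix w assume w: "length w = Suc n \<and> word_value w = m"
    then obtain u b where u: "w = u @ [b]" by (cases w rule: rev_cases) auto
    with w have "m = 2 * word_value u + of_bool b" "length u = n"
      by (auto simp: word_value_snoc)
    then show "w = v @ [odd m]" using uniq[of u] u by auto
  qed
qed

lemma finite_design:
  assumes "m < 2 ^ n"
  shows "length (finite_design m n) = n" "word_value (finite_design m n) = m"
  using theI'[OF ex1_word[OF assms]] unfolding finite_design_def by auto

datatype design = Finite "bool list" | Infinite "nat \<Rightarrow> bool" | Terminal nat

definition eventually_constant :: "(nat \<Rightarrow> bool) \<Rightarrow> bool" where
  "eventually_constant s \<longleftrightarrow> (\<exists>b N. \<forall>i\<ge>N. s i = b)"

fun is_design :: "design \<Rightarrow> bool" where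
  "is_design (Finite w) = True"
| "is_design (Infinite s) = (\<not> eventually_constant s)"
| "is_design (Terminal n) = True"

fun design_decimal :: "design \<Rightarrow> real" where
  "design_decimal (Finite w) = (\<Sum>i<length w. of_bool (w ! i) / 2 ^ (i + 1))"
| "design_decimal (Infinite s) = (\<Sum>i. of_bool (s i) / 2 ^ (i + 1))"
| "design_decimal (Terminal n) = 1"

fun design_comp :: "bool list \<Rightarrow> design \<Rightarrow> design" where
  "design_comp D (Finite w) = Finite (D @ w)"
| "design_comp D (Infinite s) =
    Infinite (\<lambda>i. if i < length D then D ! i else s (i - length D))"
| "design_comp D (Terminal n') =
    (let n = length D; m = word_value D in
      if m \<noteq> 2 ^ n - 1 then Finite (finite_design (2 ^ n' * (m + 1)) (n + n'))
      else Terminal (n + n'))"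

section \<open>Matrix action\<close>

definition design_matrix :: "bool list \<Rightarrow> real^2^2" where
  "design_matrix D =
    (let n = length D; m = word_value D in
      vector [vector [real (stern n (m + 1)), real (stern n m)],
              vector [real (stern n (2 ^ n - (m + 1))), real (stern n (2 ^ n - m))]])"

(* For arguments in [0,\<infinity>]; nonnegativity is not enforced by the type. *)
definition matrix_action :: "real^2^2 \<Rightarrow> ereal \<Rightarrow> ereal" where
  "matrix_action M x =
    (if x = \<infinity> then (if M $ 2 $ 1 = 0 then \<infinity> else ereal (M $ 1 $ 1 / M $ 2 $ 1))
     else ereal ((M $ 1 $ 1 * real_of_ereal x + M $ 1 $ 2) /
                 (M $ 2 $ 1 * real_of_ereal x + M $ 2 $ 2)))"

end

theory Submission
  imports Defs
begin

text \<open>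
  Stern's integers satisfy the bilinear composition law
  \<open>[2^(n+k) : 2^k m + j] = [2^n : m+1] [2^k : j] + [2^n : m] [2^k : 2^k - j]\<close>.
  Applied to numerator and denominator of a dyadic quotient it says that
  \<open>\<A>((m + \<theta>) / 2^n) = U(D) \<A>(\<theta>)\<close> for dyadic \<open>\<theta> < 1\<close>. Both sides are continuous in
  \<open>\<theta> \<in> [0,1)\<close>, so the identity holds there; \<open>\<theta> = 1\<close> is a direct evaluation.
\<close>

section \<open>The bilinear composition law for Stern's integers\<close>

lemma stern_comp:
  "j \<le> 2 ^ k \<Longrightarrow>
    stern (n + k) (2 ^ k * m + j) = stern n (m + 1) * stern k j + stern n m * stern k (2 ^ k - j)"
proof (induction k arbitrary: j)
  case 0
  then have "j = 0 \<or> j = 1" by auto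
  then show ?case by auto
next
  case (Suc k)
  show ?case
  proof (cases "even j")
    case True
    then obtain i where i: "j = 2 * i" by auto
    \<comment> \<open>All three arguments that depend on \<open>j\<close> are even, so the law at
      level \<open>Suc k\<close> is literally the one at level \<open>k\<close> for
      \<open>i\<close>.\<close>
    have eqs: "2 ^ Suc k * m + j = 2 * (2 ^ k * m + i)" "2 ^ Suc k - j = 2 * (2 ^ k - i)"
      using i by auto
    show ?thesis unfolding eqs add_Suc_right unfolding i stern_even
      by (rule Suc.IH) (use i Suc.prems in simp)
  next
    case False
    then obtain i where i: "j = 2 * i + 1" by (auto elim: oddE)
    have le: "i + 1 \<le> 2 ^ k" using i Suc.prems by simp
    \<comment> \<open>Every odd entry is the sum of its two neighbours one level up. The third
      equation identifies the neighbours of the complement as the complements of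
      \<open>i + 1\<close> and \<open>i\<close>, so the claim is the sum of the induction hypotheses
      for these two.\<close>
    have eqs: "2 ^ Suc k * m + j = 2 * (2 ^ k * m + i) + 1"
      "2 ^ Suc k - j = 2 * (2 ^ k - (i + 1)) + 1" "2 ^ k - (i + 1) + 1 = 2 ^ k - i"
      using i le by auto
    show ?thesis unfolding eqs add_Suc_right unfolding i stern_odd eqs
      using Suc.IH[of i] Suc.IH[of "i + 1"] le by (simp add: algebra_simps)
  qed
qed

text \<open>Reflection maps block \<open>m\<close> to block \<open>l = 2 ^ n - (m + 1)\<close> and
  offset \<open>j\<close> to \<open>2 ^ k - j\<close>, so this is \<open>stern_comp\<close> at the
  reflected position. It supplies the denominator of the composed dyadic quotient.\<close>

lemma stern_comp_complement:
  assumes "m < 2 ^ n" "j \<le> 2 ^ k"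
  shows "stern (n + k) (2 ^ (n + k) - (2 ^ k * m + j)) =
    stern n (2 ^ n - (m + 1)) * stern k j + stern n (2 ^ n - m) * stern k (2 ^ k - j)"
proof -
  obtain l where l: "2 ^ n = m + 1 + l" using assms(1) by (metis Suc_eq_plus1 Suc_leI le_Suc_ex)
  have "2 ^ (n + k) = 2 ^ k * m + 2 ^ k + 2 ^ k * l"
    unfolding power_add l by (simp add: algebra_simps)
  then have "2 ^ (n + k) - (2 ^ k * m + j) = 2 ^ k * l + (2 ^ k - j)"
    using assms(2) by simp
  moreover have "2 ^ n - (m + 1) = l" "2 ^ n - m = l + 1" using l by simp_all
  ultimately show ?thesis using stern_comp[of "2 ^ k - j" k n l] assms(2) by simp
qed

section \<open>Composition for the assembly function on [0,1)\<close>

lemma assembly_fun_dyadic: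
  "m < 2 ^ n \<Longrightarrow> assembly_fun (real m / 2 ^ n) = real (stern n m) / real (stern n (2 ^ n - m))"
  using is_assembly_assembly_fun unfolding is_assembly_def extends_dyadic_quotients_def by blast

lemma assembly_fun_nonneg: "x \<in> {0..<1} \<Longrightarrow> 0 \<le> assembly_fun x"
  using is_assembly_assembly_fun unfolding is_assembly_def bij_betw_def by auto

lemma continuous_on_assembly_fun: "continuous_on {0..<1} assembly_fun"
  using is_assembly_assembly_fun unfolding is_assembly_def by blast

lemma shifted_unit_interval:
  fixes x :: real
  assumes "m < 2 ^ n" "x \<in> {0..<1}" shows "(real m + x) / 2 ^ n \<in> {0..<1}"
proof -
  have "real (m + 1) \<le> real (2 ^ n)" using assms(1) by (simp only: of_nat_le_iff)
  then show ?thesis using assms(2) by simp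
qed

lemma assembly_fun_comp_dyadic:
  assumes "m < 2 ^ n" "j < 2 ^ k"
  defines "x \<equiv> assembly_fun (real j / 2 ^ k)"
  shows "assembly_fun ((real m + real j / 2 ^ k) / 2 ^ n) =
    (real (stern n (m + 1)) * x + real (stern n m)) /
    (real (stern n (2 ^ n - (m + 1))) * x + real (stern n (2 ^ n - m)))"
proof -
  let ?p = "real (stern k j)" and ?q = "real (stern k (2 ^ k - j))"
  have q: "?q > 0" using assms(2) by (auto intro: stern_pos)
  have x: "x = ?p / ?q" unfolding x_def by (rule assembly_fun_dyadic[OF assms(2)])
  have "2 ^ k * m + j < 2 ^ k * (m + 1)" using assms(2) by simp
  also have "\<dots> \<le> 2 ^ k * 2 ^ n" using assms(1) by (intro mult_le_mono2) simp
  finally have lt: "2 ^ k * m + j < 2 ^ (n + k)" by (simp add: power_add mult.commute)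
  have "(real m + real j / 2 ^ k) / 2 ^ n = real (2 ^ k * m + j) / 2 ^ (n + k)"
    by (simp add: field_simps power_add)
  then have "assembly_fun ((real m + real j / 2 ^ k) / 2 ^ n) =
      (real (stern n (m + 1)) * ?p + real (stern n m) * ?q) /
      (real (stern n (2 ^ n - (m + 1))) * ?p + real (stern n (2 ^ n - m)) * ?q)"
    using assembly_fun_dyadic[OF lt] stern_comp[of j k n m] stern_comp_complement[OF assms(1), of j k]
      assms(2) by simp
  \<comment> \<open>Dividing through by \<open>?q > 0\<close> turns the linear forms in
    \<open>(?p, ?q)\<close> into a Moebius map of \<open>x = ?p / ?q\<close>.\<close>
  also have "\<dots> = ((real (stern n (m + 1)) * ?p + real (stern n m) * ?q) / ?q) /
      ((real (stern n (2 ^ n - (m + 1))) * ?p + real (stern n (2 ^ n - m)) * ?q) / ?q)"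
    using q by simp
  also have "\<dots> = (real (stern n (m + 1)) * x + real (stern n m)) /
    (real (stern n (2 ^ n - (m + 1))) * x + real (stern n (2 ^ n - m)))"
    unfolding x using q by (simp add: add_divide_distrib)
  finally show ?thesis .
qed

lemma dyadic_floor_tendsto:
  fixes x :: real
  assumes "0 \<le> x" shows "(\<lambda>k. real (nat \<lfloor>x * 2 ^ k\<rfloor>) / 2 ^ k) \<longlonglongrightarrow> x"
proof (rule real_tendsto_sandwich)
  have fl: "x * 2 ^ k - 1 \<le> real (nat \<lfloor>x * 2 ^ k\<rfloor>)" "real (nat \<lfloor>x * 2 ^ k\<rfloor>) \<le> x * 2 ^ k" for k
    using assms floor_correct[of "x * 2 ^ k"] by simp_all
  show "\<forall>\<^sub>F k in sequentially. x - (1/2) ^ k \<le> real (nat \<lfloor>x * 2 ^ k\<rfloor>) / 2 ^ k"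
  proof (intro always_eventually allI)
    fix k
    have "x - (1/2) ^ k = (x * 2 ^ k - 1) / 2 ^ k" by (simp add: power_one_over diff_divide_distrib)
    also have "\<dots> \<le> real (nat \<lfloor>x * 2 ^ k\<rfloor>) / 2 ^ k" by (rule divide_right_mono[OF fl(1)]) simp
    finally show "x - (1/2) ^ k \<le> real (nat \<lfloor>x * 2 ^ k\<rfloor>) / 2 ^ k" .
  qed
  show "\<forall>\<^sub>F k in sequentially. real (nat \<lfloor>x * 2 ^ k\<rfloor>) / 2 ^ k \<le> x"
    using fl(2) by (intro always_eventually) (simp add: field_simps)
  have "(\<lambda>k. x - (1/2) ^ k) \<longlonglongrightarrow> x - 0" by (intro tendsto_intros LIMSEQ_realpow_zero) auto
  then show "(\<lambda>k. x - (1/2) ^ k) \<longlonglongrightarrow> x" by simp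
qed simp

lemma assembly_fun_comp:
  assumes m: "m < 2 ^ n" and x: "x \<in> {0..<1}"
  shows "assembly_fun ((real m + x) / 2 ^ n) =
    (real (stern n (m + 1)) * assembly_fun x + real (stern n m)) /
    (real (stern n (2 ^ n - (m + 1))) * assembly_fun x + real (stern n (2 ^ n - m)))"
    (is "_ = ?R x")
proof -
  define j where "j k = nat \<lfloor>x * 2 ^ k\<rfloor>" for k
  \<comment> \<open>Rounding down keeps the dyadic approximants inside [0,1), where the dyadic law
    and continuity are available; this uses \<open>x < 1\<close>.\<close>
  have j: "j k < 2 ^ k" for k
    using x by (simp add: j_def nat_less_iff floor_less_iff)
  let ?\<theta> = "\<lambda>k. real (j k) / 2 ^ k"
  have \<theta>: "?\<theta> k \<in> {0..<1}" for k using j[of k] by (simp add: divide_simps)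
  have lim: "?\<theta> \<longlonglongrightarrow> x" using dyadic_floor_tendsto[of x] x unfolding j_def by simp
  have A: "(\<lambda>k. assembly_fun (?\<theta> k)) \<longlonglongrightarrow> assembly_fun x"
    by (rule continuous_on_tendsto_compose[OF continuous_on_assembly_fun lim x])
       (use \<theta> in \<open>auto intro: always_eventually\<close>)
  have "(\<lambda>k. (real m + ?\<theta> k) / 2 ^ n) \<longlonglongrightarrow> (real m + x) / 2 ^ n"
    by (intro tendsto_intros lim) simp
  then have L: "(\<lambda>k. assembly_fun ((real m + ?\<theta> k) / 2 ^ n)) \<longlonglongrightarrow> assembly_fun ((real m + x) / 2 ^ n)"
    by (rule continuous_on_tendsto_compose[OF continuous_on_assembly_fun])
       (use shifted_unit_interval[OF m] \<theta> x in \<open>blast intro: always_eventually\<close>)+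
  \<comment> \<open>The constant term of the denominator is positive and the other term is
    nonnegative, so the quotient may be passed to the limit.\<close>
  have "0 < stern n (2 ^ n - m)" using m by (auto intro: stern_pos)
  then have "real (stern n (2 ^ n - (m + 1))) * assembly_fun x + real (stern n (2 ^ n - m)) \<noteq> 0"
    using assembly_fun_nonneg[OF x] by (intro less_imp_neq[symmetric] add_nonneg_pos) auto
  then have "(\<lambda>k. ?R (?\<theta> k)) \<longlonglongrightarrow> ?R x"
    by (intro tendsto_intros A)
  then show ?thesis
    using L assembly_fun_comp_dyadic[OF m j] LIMSEQ_unique by simp
qed

section \<open>Words and design decimals\<close>

lemma word_value_append: "word_value (v @ w) = 2 ^ length w * word_value v + word_value w"
proof (induction w rule: rev_induct)
  case Nil
  then show ?case by (simp add: word_value_def)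
next
  case (snoc b w)
  then show ?case by (simp add: word_value_snoc flip: append_assoc)
qed

lemma word_value_less: "word_value w < 2 ^ length w"
  by (induction w rule: rev_induct) (auto simp: word_value_snoc, simp add: word_value_def)

lemma sum_bits_eq_word_value:
  "(\<Sum>i<length w. of_bool (w ! i) / 2 ^ (i + 1)) = real (word_value w) / 2 ^ length w"
proof -
  have "of_bool (w ! i) / 2 ^ (i + 1) =
      real (2 ^ (length w - (i + 1)) * of_bool (w ! i)) / 2 ^ length w"
    if "i < length w" for i
  proof -
    have "(2::real) ^ length w = 2 ^ (length w - (i + 1)) * 2 ^ (i + 1)"
      using that by (simp flip: power_add del: power_Suc)
    then show ?thesis by simp
  qed
  then show ?thesis
    unfolding word_value_def of_nat_sum sum_divide_distrib by (intro sum.cong) auto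
qed

lemma summable_bits: "summable (\<lambda>i. of_bool (s i) / 2 ^ (i + 1) :: real)"
proof (rule summable_comparison_test')
  show "summable (\<lambda>i. (1/2::real) ^ Suc i)" using power_half_series by (rule sums_summable)
  show "norm (of_bool (s i) / 2 ^ (i + 1) :: real) \<le> (1/2) ^ Suc i" for i
    by (simp add: power_one_over)
qed

text \<open>The series of \<open>s\<close> and of its bitwise negation add up to the geometric
  series with sum 1, and the false bit \<open>i\<close> makes the second one positive.\<close>

lemma sum_bits_less_one:
  assumes "\<not> s i" shows "(\<Sum>i. of_bool (s i) / 2 ^ (i + 1)) < (1::real)"
proof -
  have "(\<Sum>i. of_bool (s i) / 2 ^ (i + 1)) + (\<Sum>i. of_bool (\<not> s i) / 2 ^ (i + 1))
      = (\<Sum>i. of_bool (s i) / 2 ^ (i + 1) + of_bool (\<not> s i) / 2 ^ (i + 1) :: real)"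
    using summable_bits[of s] summable_bits[of "\<lambda>i. \<not> s i"] by (rule suminf_add)
  also have "\<dots> = (\<Sum>i. (1/2) ^ Suc i)"
    by (intro suminf_cong) (auto simp: power_one_over)
  also have "\<dots> = 1" using power_half_series by (rule sums_unique[symmetric])
  finally have "(\<Sum>i. of_bool (s i) / 2 ^ (i + 1)) + (\<Sum>i. of_bool (\<not> s i) / 2 ^ (i + 1)) = (1::real)" .
  moreover have "0 < (\<Sum>i. of_bool (\<not> s i) / 2 ^ (i + 1) :: real)"
    by (rule suminf_pos2[OF summable_bits, of _ i]) (use assms in auto)
  ultimately show ?thesis by linarith
qed

lemma design_decimal_range:
  assumes "is_design D'" "\<And>k. D' \<noteq> Terminal k" shows "design_decimal D' \<in> {0..<1}"
proof (cases D')
  case (Finite w)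
  have "real (word_value w) < 2 ^ length w" using word_value_less[of w] by simp
  then show ?thesis using Finite sum_bits_eq_word_value[of w] by simp
next
  case (Infinite s)
  \<comment> \<open>Without a false bit, \<open>s\<close> would be constantly true.\<close>
  then obtain i where "\<not> s i" using assms(1) by (auto simp: eventually_constant_def)
  moreover have "0 \<le> (\<Sum>i. of_bool (s i) / 2 ^ (i + 1) :: real)"
    by (rule suminf_nonneg[OF summable_bits]) simp
  ultimately show ?thesis using Infinite sum_bits_less_one[of s i] by simp
qed (use assms in simp)

text \<open>This reduces all three kinds of design to the single question of how
  \<open>assembly\<close> behaves under \<theta> -> (m + \<theta>) / 2^n. For an infinite design,
  split the series after the prefix \<open>D\<close>; the tail is the series of \<open>s\<close>
  scaled by 2^-n.\<close>

lemma design_decimal_comp: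
  "design_decimal (design_comp D D') = (real (word_value D) + design_decimal D') / 2 ^ length D"
proof (cases D')
  case (Finite w)
  then show ?thesis
    by (simp only: design_comp.simps design_decimal.simps sum_bits_eq_word_value)
      (simp add: word_value_append field_simps power_add)
next
  case (Infinite s)
  define t where "t i = (if i < length D then D ! i else s (i - length D))" for i
  have "(\<Sum>i. of_bool (t i) / 2 ^ (i + 1) :: real) =
      (\<Sum>i. of_bool (t (i + length D)) / 2 ^ (i + length D + 1)) +
      (\<Sum>i<length D. of_bool (t i) / 2 ^ (i + 1))"
    by (rule suminf_split_initial_segment[OF summable_bits])
  also have "(\<Sum>i. of_bool (t (i + length D)) / 2 ^ (i + length D + 1) :: real)
      = (\<Sum>i. of_bool (s i) / 2 ^ (i + 1) / 2 ^ length D)"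
    by (intro suminf_cong) (simp add: t_def power_add)
  also have "\<dots> = (\<Sum>i. of_bool (s i) / 2 ^ (i + 1)) / 2 ^ length D"
    by (rule suminf_divide[OF summable_bits])
  also have "(\<Sum>i<length D. of_bool (t i) / 2 ^ (i + 1) :: real)
      = (\<Sum>i<length D. of_bool (D ! i) / 2 ^ (i + 1))"
    by (intro sum.cong) (auto simp: t_def)
  finally show ?thesis
    using Infinite unfolding sum_bits_eq_word_value
    by (simp add: t_def[abs_def] add_divide_distrib)
next
  case (Terminal k)
  let ?n = "length D" and ?m = "word_value D"
  show ?thesis
  proof (cases "?m = 2 ^ ?n - 1")
    case True
    then have "real ?m + 1 = 2 ^ ?n" by (simp add: of_nat_diff)
    then show ?thesis using Terminal True by simp
  next
    case False
    then have "?m + 1 < 2 ^ ?n" using word_value_less[of D] by linarith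
    \<comment> \<open>This bound guarantees that the description inside \<open>finite_design\<close>
      denotes a unique word, whose length and value can then be read off.\<close>
    then have lt: "2 ^ k * (?m + 1) < 2 ^ (?n + k)"
      unfolding power_add mult.commute[of "2 ^ ?n"] by (intro mult_strict_left_mono) simp_all
    have "design_comp D D' = Finite (finite_design (2 ^ k * (?m + 1)) (?n + k))"
      using Terminal False by (simp add: Let_def)
    then have "design_decimal (design_comp D D') = real (2 ^ k * (?m + 1)) / 2 ^ (?n + k)"
      by (simp only: design_decimal.simps sum_bits_eq_word_value) (simp only: finite_design[OF lt])
    also have "\<dots> = (real ?m + design_decimal D') / 2 ^ ?n"
      using Terminal by (simp add: power_add field_simps)
    finally show ?thesis .
  qed
qed

section \<open>The matrix action and the terminal case\<close>

lemma matrix_action_design_matrix: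
  fixes D :: "bool list"
  defines "n \<equiv> length D" and "m \<equiv> word_value D"
  shows "matrix_action (design_matrix D) (ereal x) =
      ereal ((real (stern n (m + 1)) * x + real (stern n m)) /
        (real (stern n (2 ^ n - (m + 1))) * x + real (stern n (2 ^ n - m))))"
    and "matrix_action (design_matrix D) \<infinity> =
      (if stern n (2 ^ n - (m + 1)) = 0 then \<infinity>
       else ereal (real (stern n (m + 1)) / real (stern n (2 ^ n - (m + 1)))))"
  by (simp_all add: matrix_action_def design_matrix_def Let_def n_def m_def)

text \<open>At \<theta> = 1 the ratio a/c of the first column of U(D) is the dyadic quotient at (m +
  1) / 2^n. If m + 1 = 2^n, then c = [2^n : 0] = 0 and both sides are infinite.\<close>

lemma assembly_comp_one:
  fixes D :: "bool list"
  shows "assembly ((real (word_value D) + 1) / 2 ^ length D)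
    = matrix_action (design_matrix D) \<infinity>"
proof (cases "word_value D + 1 = 2 ^ length D")
  case True
  then have "real (word_value D) + 1 = 2 ^ length D"
    by (metis of_nat_1 of_nat_add of_nat_numeral of_nat_power)
  then show ?thesis
    using True by (simp add: matrix_action_design_matrix(2) assembly_def)
next
  case False
  then have lt: "word_value D + 1 < 2 ^ length D" using word_value_less[of D] by linarith
  then have "real (word_value D + 1) < real (2 ^ length D)" by (simp only: of_nat_less_iff)
  then have "(real (word_value D) + 1) / 2 ^ length D \<noteq> 1" by simp
  moreover have "0 < stern (length D) (2 ^ length D - (word_value D + 1))"
    using lt by (intro stern_pos) auto
  ultimately show ?thesis
    using assembly_fun_dyadic[OF lt]
    by (simp add: matrix_action_design_matrix(2) assembly_def add.commute)
qed

theorem theorem6p10: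
  fixes n m :: nat and D :: "bool list" and D' :: design
  assumes "m \<le> 2 ^ n - 1"
    and "D = finite_design m n"
    and "is_design D'"
  shows "assembly (design_decimal (design_comp D D'))
       = matrix_action (design_matrix D) (assembly (design_decimal D'))"
proof (cases "\<exists>k. D' = Terminal k")
  case True
  then have "design_decimal D' = 1" by auto
  then show ?thesis
    using assembly_comp_one[of D] unfolding design_decimal_comp by (simp add: assembly_def)
next
  case False
  then have \<theta>: "design_decimal D' \<in> {0..<1}" using design_decimal_range assms(3) by blast
  \<comment> \<open>The composed decimal also stays below 1, so both occurrences of
    \<open>assembly\<close> take their finite branch.\<close>
  moreover have "(real (word_value D) + design_decimal D') / 2 ^ length D \<in> {0..<1}"
    using shifted_unit_interval[OF word_value_less \<theta>] .
  ultimately show ?thesis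
    using assembly_fun_comp[OF word_value_less \<theta>] unfolding design_decimal_comp
    by (simp add: assembly_def matrix_action_design_matrix(1))
qed

end
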